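(* Let $(x^*,y^*,z^* )$ be a solution to the KKT system of the problem $\min_{x\in\mathcal X,\,y\in\mathcal Y}\{f(x)+g(y)\mid Ax+By=c\}$, and let $\{(x^k,y^k,z^k)\}$ be the sequence generated by the accelerated semi-proximal ADMM with variable proximal terms described in the context, with $\Sigma_f+A^*A+\mathcal S^k\succ0$ and $\Sigma_g+B^*B+\mathcal T^k\succ0$ for all $k\ge0$. Suppose that $\Sigma_f\succeq\mathcal S^{k+1}-\mathcal S^k$ and $\Sigma_g\succeq\mathcal T^{k+1}-\mathcal T^k$ for all $k\ge0$. Then, for all $K=0,1,2,\ldots$, $$-\frac{2C_3\|z^*\|}{1+K(1-\tau)}\le f(x^{K+1})+g(y^{K+1})-f(x^* )-g(y^* )\le\frac{2C_3\|z^*\|+C_4}{1+K(1-\tau)}$$ and $$0\le\|c-Ax^{K+1}-By^{K+1}\|\le\frac{2C_3}{1+K(1-\tau)},$$ where $$C_3:=\tfrac2\lambda\|z^0-z^*\|+\|By^0-By^*\|+\tfrac1{\sqrt\lambda}\big(\|x^0-x^*\|_{\mathcal S^0}+\|y^0-y^*\|_{\mathcal T^0}\big),$$ $$C_4:=\tfrac1{2\lambda}\|z^0-z^*\|^2+\tfrac\lambda2\|By^0-By^*\|^2+\tfrac12\big(\|x^0-x^*\|_{\mathcal S^0}^2+\|y^0-y^*\|_{\mathcal T^0}^2\big).$$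
   Context: $\mathcal X,\mathcal Y,\mathcal Z$ are finite-dimensional real Hilbert spaces, each with an inner product $\langle\cdot,\cdot\rangle$ and induced norm $\|\cdot\|$; $f:\mathcal X\to(-\infty,\infty]$ and $g:\mathcal Y\to(-\infty,\infty]$ are closed proper convex functions; $A:\mathcal X\to\mathcal Z$, $B:\mathcal Y\to\mathcal Z$ are linear operators with adjoints $A^*,B^*$; $c\in\mathcal Z$. For a self-adjoint positive semidefinite operator $\mathcal S$, $\|x\|_{\mathcal S}:=\sqrt{\langle x,\mathcal Sx\rangle}$. KKT system: $(x^*,y^*,z^* )$ solves it if $Ax^*+By^*=c$, $0\in\partial f(x^* )-A^*z^*$, $0\in\partial g(y^* )-B^*z^*$. $\Sigma_f:\mathcal X\to\mathcal X$ and $\Sigma_g:\mathcal Y\to\mathcal Y$ are self-adjoint positive semidefinite operators such that for all $x,\hat x\in\mathrm{dom}(f)$, $w\in\partial f(x)$, $\hat w\in\partial f(\hat x)$: $f(x)\ge f(\hat x)+\langle\hat w,x-\hat x\rangle+\frac12\|x-\hat x\|_{\Sigma_f}^2$ and $\langle w-\hat w,x-\hat x\rangle\ge\|x-\hat x\|_{\Sigma_f}^2$; and likewise for $g$ with $\Sigma_g$. Augmented Lagrangian ($\lambda>0$): $\mathcal L_\lambda(x,y,z):=f(x)+g(y)-\langle Ax+By-c,z\rangle+\frac\lambda2\|Ax+By-c\|^2$. Accelerated semi-proximal ADMM with variable proximal terms: input $x^0\in\mathcal X$, $y^0\in\mathcal Y$, $z^0\in\mathcal Z$, $y^{-1}=y^0$,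 $\lambda>0$, $\tau\in(0,1)$, $\theta^{-1}=1/\tau$ (here the superscript of $\theta$ is an iteration index, not a power), and self-adjoint positive semidefinite linear operators $\mathcal S^k:\mathcal X\to\mathcal X$, $\mathcal T^k:\mathcal Y\to\mathcal Y$, $k\ge0$. For $k=0,1,\ldots$: 1. $\theta^k:=\frac{1}{1-\tau+1/\theta^{k-1}}$, $\ v^k:=y^k+\frac{\theta^k(1-\theta^{k-1})}{\theta^{k-1}}(y^k-y^{k-1})$; 2. $x^{k+1}:=\arg\min_x\ \mathcal L_{\lambda/\theta^k}(x,v^k,z^k)+\frac12\|x-x^k\|_{\mathcal S^k}^2$; 3. $y^{k+1}:=\arg\min_y\ \mathcal L_{\lambda/\theta^k}(x^{k+1},y,z^k)+\frac12\|y-y^k\|_{\mathcal T^k}^2$; 4. $z^{k+1}:=z^k-\tau\lambda(Ax^{k+1}+By^{k+1}-c)$.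
   Formalization: The constant g(v^k) is dropped from the x-subproblem, since v^k (already v^0 = y^0) may lie outside dom(g), which would make the objective identically +∞ and x^{k+1} undefined; the spaces have dimension at least one. *)

theory Defs
  imports "HOL-Analysis.Analysis"
begin

definition edom :: "('a \<Rightarrow> ereal) \<Rightarrow> 'a set" where
  "edom f = {x. f x < \<infinity>}"

text \<open>Epigraph of an extended-valued function; the library's \<open>epigraph\<close> is for real-valued ones.\<close>

definition epi :: "('a \<Rightarrow> ereal) \<Rightarrow> ('a \<times> real) set" where
  "epi f = {(x, r). f x \<le> ereal r}"

definition closed_proper_convex :: "('a::euclidean_space \<Rightarrow> ereal) \<Rightarrow> bool" where
  "closed_proper_convex f \<longleftrightarrow>
     (\<forall>x. f x \<noteq> -\<infinity>) \<and> edom f \<noteq> {} \<and> convex (epi f) \<and> closed (epi f)"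

definition subdifferential :: "('a::euclidean_space \<Rightarrow> ereal) \<Rightarrow> 'a \<Rightarrow> 'a set" where
  "subdifferential f x = {w. \<forall>u. f u \<ge> f x + ereal (w \<bullet> (u - x))}"

definition self_adjoint :: "('a::euclidean_space \<Rightarrow> 'a) \<Rightarrow> bool" where
  "self_adjoint S \<longleftrightarrow> linear S \<and> adjoint S = S"

definition psd :: "('a::euclidean_space \<Rightarrow> 'a) \<Rightarrow> bool" where
  "psd S \<longleftrightarrow> self_adjoint S \<and> (\<forall>x. 0 \<le> x \<bullet> S x)"

definition pos_def :: "('a::euclidean_space \<Rightarrow> 'a) \<Rightarrow> bool" where
  "pos_def S \<longleftrightarrow> self_adjoint S \<and> (\<forall>x. x \<noteq> 0 \<longrightarrow> 0 < x \<bullet> S x)"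

definition loewner_ge :: "('a::euclidean_space \<Rightarrow> 'a) \<Rightarrow> ('a \<Rightarrow> 'a) \<Rightarrow> bool"
  (infix \<open>\<succeq>\<close> 50) where
  "P \<succeq> Q \<longleftrightarrow> psd (\<lambda>x. P x - Q x)"

definition seminorm :: "('a::euclidean_space \<Rightarrow> 'a) \<Rightarrow> 'a \<Rightarrow> real" where
  "seminorm S x = sqrt (x \<bullet> S x)"

definition convexity_modulus :: "('a::euclidean_space \<Rightarrow> ereal) \<Rightarrow> ('a \<Rightarrow> 'a) \<Rightarrow> bool" where
  "convexity_modulus f \<Sigma> \<longleftrightarrow> psd \<Sigma> \<and>
     (\<forall>x\<in>edom f. \<forall>x'\<in>edom f. \<forall>w\<in>subdifferential f x. \<forall>w'\<in>subdifferential f x'.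
        f x \<ge> f x' + ereal (w' \<bullet> (x - x') + 1/2 * (seminorm \<Sigma> (x - x'))\<^sup>2) \<and>
        (w - w') \<bullet> (x - x') \<ge> (seminorm \<Sigma> (x - x'))\<^sup>2)"

definition KKT_solution ::
  "('x::euclidean_space \<Rightarrow> ereal) \<Rightarrow> ('y::euclidean_space \<Rightarrow> ereal) \<Rightarrow>
   ('x \<Rightarrow> 'z::euclidean_space) \<Rightarrow> ('y \<Rightarrow> 'z) \<Rightarrow> 'z \<Rightarrow> 'x \<Rightarrow> 'y \<Rightarrow> 'z \<Rightarrow> bool" where
  "KKT_solution f g A B c x y z \<longleftrightarrow>
     A x + B y = c \<and>
     0 \<in> (\<lambda>w. w - adjoint A z) ` subdifferential f x \<and>
     0 \<in> (\<lambda>w. w - adjoint B z) ` subdifferential g y"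

definition aug_lagrangian ::
  "('x::euclidean_space \<Rightarrow> ereal) \<Rightarrow> ('y::euclidean_space \<Rightarrow> ereal) \<Rightarrow>
   ('x \<Rightarrow> 'z::euclidean_space) \<Rightarrow> ('y \<Rightarrow> 'z) \<Rightarrow> 'z \<Rightarrow> real \<Rightarrow> 'x \<Rightarrow> 'y \<Rightarrow> 'z \<Rightarrow> ereal" where
  "aug_lagrangian f g A B c lam x y z =
     f x + g y + ereal (- ((A x + B y - c) \<bullet> z) + lam / 2 * (norm (A x + B y - c))\<^sup>2)"

text \<open>\<open>prev a s k\<close> is the term with index \<open>k - 1\<close> of the sequence \<open>s\<close> started at index \<open>-1\<close>
  with the value \<open>a\<close>.\<close>

definition prev :: "'a \<Rightarrow> (nat \<Rightarrow> 'a) \<Rightarrow> nat \<Rightarrow> 'a" where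
  "prev a s k = (case k of 0 \<Rightarrow> a | Suc j \<Rightarrow> s j)"

text \<open>The extrapolated point \<open>v k\<close> (and already \<open>v 0 = y 0\<close>) may lie outside \<open>edom g\<close>.
  The summand \<open>g (v k)\<close> of the augmented Lagrangian does not depend on the variable of the
  \<open>x\<close>-subproblem, so it is left out by putting the zero function in place of \<open>g\<close>. Keeping it would
  make the objective identically \<open>\<infinity>\<close>, and every point a minimizer, whenever \<open>g (v k) = \<infinity>\<close>.
  In the \<open>y\<close>-subproblem \<open>f (x (Suc k))\<close> is finite.\<close>

definition accelerated_sPADMM ::
  "('x::euclidean_space \<Rightarrow> ereal) \<Rightarrow> ('y::euclidean_space \<Rightarrow> ereal) \<Rightarrow>
   ('x \<Rightarrow> 'z::euclidean_space) \<Rightarrow> ('y \<Rightarrow> 'z) \<Rightarrow> 'z \<Rightarrow> real \<Rightarrow> real \<Rightarrow>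
   (nat \<Rightarrow> 'x \<Rightarrow> 'x) \<Rightarrow> (nat \<Rightarrow> 'y \<Rightarrow> 'y) \<Rightarrow>
   (nat \<Rightarrow> real) \<Rightarrow> (nat \<Rightarrow> 'y) \<Rightarrow> (nat \<Rightarrow> 'x) \<Rightarrow> (nat \<Rightarrow> 'y) \<Rightarrow> (nat \<Rightarrow> 'z) \<Rightarrow> bool" where
  "accelerated_sPADMM f g A B c lam \<tau> S T \<theta> v x y z \<longleftrightarrow>
     (\<forall>k.
        \<theta> k = 1 / (1 - \<tau> + 1 / prev (1 / \<tau>) \<theta> k) \<and>
        v k = y k + (\<theta> k * (1 - prev (1 / \<tau>) \<theta> k) / prev (1 / \<tau>) \<theta> k) *\<^sub>R
                      (y k - prev (y 0) y k) \<and>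
        is_arg_min (\<lambda>u. aug_lagrangian f (\<lambda>_. 0) A B c (lam / \<theta> k) u (v k) (z k)
                         + ereal (1/2 * (seminorm (S k) (u - x k))\<^sup>2))
                   (\<lambda>_. True) (x (Suc k)) \<and>
        is_arg_min (\<lambda>u. aug_lagrangian f g A B c (lam / \<theta> k) (x (Suc k)) u (z k)
                         + ereal (1/2 * (seminorm (T k) (u - y k))\<^sup>2))
                   (\<lambda>_. True) (y (Suc k)) \<and>
        z (Suc k) = z k - (\<tau> * lam) *\<^sub>R (A (x (Suc k)) + B (y (Suc k)) - c))"

end

theory Submission
  imports Defs
begin

text \<open>
  Put \<open>\<beta>\<^sub>k = 1 / \<theta>\<^sup>k = 1 + k (1 - \<tau>)\<close> and let \<open>r\<^sup>k = A x\<^sup>k + B y\<^sup>k - c\<close> be the residual. The rate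
  is that of a Nesterov-type scheme whose weights \<open>\<beta>\<^sub>k\<close> grow linearly. Three sequences
  make the argument work: the averaged steps \<open>\<beta>\<^sub>k x\<^sup>k\<^sup>+\<^sup>1 - (\<beta>\<^sub>k - 1) x\<^sup>k\<close>, their analogues \<open>u\<^sup>k\<^sup>+\<^sup>1\<close> for
  \<open>y\<close>, and the predicted multipliers \<open>p\<^sup>k = z\<^sup>k - \<lambda> (\<beta>\<^sub>k - 1) r\<^sup>k\<close>. The latter are the multipliers in
  the optimality conditions of the \<open>y\<close>-subproblems, and since
  \<open>\<beta>\<^sub>k\<^sub>+\<^sub>1 - 1 = \<beta>\<^sub>k - \<tau>\<close>, the increment \<open>p\<^sup>k\<^sup>+\<^sup>1 - p\<^sup>k\<close> is \<open>- \<lambda> (\<beta>\<^sub>k r\<^sup>k\<^sup>+\<^sup>1 - (\<beta>\<^sub>k - 1) r\<^sup>k)\<close>.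
  The extrapolation \<open>v\<^sup>k\<close> is chosen so that \<open>\<beta>\<^sub>k (y\<^sup>k\<^sup>+\<^sup>1 - v\<^sup>k) = u\<^sup>k\<^sup>+\<^sup>1 - u\<^sup>k\<close>.

  Let \<open>L\<^sup>k\<close> be the gap of the Lagrangian with multiplier \<open>z\<^sup>*\<close> between \<open>(x\<^sup>k, y\<^sup>k)\<close> and the solution; it
  is nonnegative for \<open>k \<ge> 1\<close>. Each subproblem gives a subgradient at the new iterate. Testing it
  with weight \<open>1\<close> at the solution and weight \<open>\<beta>\<^sub>k - 1\<close> at the old iterate
  (\<open>proximal_step_inequality\<close>), and summing over both blocks, leaves inner products of increments
  of \<open>p\<close> and \<open>B u\<close>, which \<open>primal_dual_coupling_inequality\<close> turns into differences of squares. The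
  result is \<open>energy_step\<close>,
  \<open>\<beta>\<^sub>k L\<^sup>k\<^sup>+\<^sup>1 + E\<^sup>k\<^sup>+\<^sup>1 \<le> (\<beta>\<^sub>k - 1) L\<^sup>k + E\<^sup>k\<close>, for the energy
  \<open>E\<^sup>k = |p\<^sup>k - z\<^sup>*|\<^sup>2 / (2 \<lambda>) + \<lambda>/2 |B u\<^sup>k - B y\<^sup>*|\<^sup>2\<close> plus half the squared seminorms of \<open>x\<^sup>k - x\<^sup>*\<close> and
  \<open>y\<^sup>k - y\<^sup>*\<close> in the current proximal metrics. Convexity moduli pay for the change of metric.
  As \<open>\<beta>\<^sub>0 = 1\<close>, summation gives \<open>\<beta>\<^sub>K L\<^sup>K\<^sup>+\<^sup>1 + E\<^sup>K\<^sup>+\<^sup>1 \<le> E\<^sup>0 = C\<^sub>4\<close>.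

  This bounds \<open>L\<close>, but the objective differs from \<open>L\<close> by \<open>\<langle>z\<^sup>*, r\<rangle>\<close>, so the residual needs its own
  estimate. The energy bounds \<open>|p\<^sup>k - z\<^sup>*|\<close> by \<open>M = sqrt (2 \<lambda> C\<^sub>4)\<close>. The multiplier update reads
  \<open>z\<^sup>k\<^sup>+\<^sup>1 = (1 - \<tau>/\<beta>\<^sub>k) z\<^sup>k + (\<tau>/\<beta>\<^sub>k) p\<^sup>k\<^sup>+\<^sup>1\<close>, a convex combination, so \<open>|z\<^sup>k - z\<^sup>*| \<le> M\<close> as well
  (\<open>multiplier_dist\<close>), and \<open>\<lambda> \<beta>\<^sub>k r\<^sup>k\<^sup>+\<^sup>1 = z\<^sup>k - p\<^sup>k\<^sup>+\<^sup>1\<close> has norm at most \<open>2 M \<le> 2 \<lambda> C\<^sub>3\<close>.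
\<close>

section \<open>Subgradients at minimizers of smooth perturbations\<close>

lemma proper_subdifferential_imp_finite:
  assumes "closed_proper_convex f" and "w \<in> subdifferential f p"
  shows "\<bar>f p\<bar> \<noteq> \<infinity>"
proof -
  obtain u where "f u < \<infinity>" "\<And>x. f x \<noteq> -\<infinity>"
    using assms(1) by (auto simp: closed_proper_convex_def edom_def)
  moreover have "f p + ereal (w \<bullet> (u - p)) \<le> f u"
    using assms(2) by (auto simp: subdifferential_def)
  ultimately show ?thesis by (cases "f p") auto
qed

lemma real_subgradient_inequality:
  assumes "w \<in> subdifferential f p" and "\<bar>f p\<bar> \<noteq> \<infinity>" and "\<bar>f u\<bar> \<noteq> \<infinity>"
  shows "real_of_ereal (f p) + w \<bullet> (u - p) \<le> real_of_ereal (f u)"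
proof -
  have "f p + ereal (w \<bullet> (u - p)) \<le> f u"
    using assms(1) by (auto simp: subdifferential_def)
  then show ?thesis
    using assms(2,3) by (cases "f p"; cases "f u") auto
qed

text \<open>Fermat's rule. Along the segment towards any \<open>u\<close> in the domain convexity bounds the
  increment of \<open>f\<close> by \<open>t (f u - f p)\<close>, so minimality says that the difference quotient of \<open>q\<close> at
  \<open>t\<close> is at least \<open>f p - f u\<close>; letting \<open>t\<close> tend to \<open>0\<close> gives the subgradient inequality.\<close>

lemma arg_min_add_differentiable_imp_subgradient:
  fixes f :: "'a::euclidean_space \<Rightarrow> ereal" and q :: "'a \<Rightarrow> real"
  assumes f: "closed_proper_convex f"
    and min: "is_arg_min (\<lambda>u. f u + ereal (q u)) (\<lambda>_. True) p"
    and deriv: "(q has_derivative (\<lambda>h. d \<bullet> h)) (at p)"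
  shows "- d \<in> subdifferential f p" and "\<bar>f p\<bar> \<noteq> \<infinity>"
proof -
  obtain u0 where u0: "f u0 < \<infinity>" and proper: "\<And>x. f x \<noteq> -\<infinity>" and conv: "convex (epi f)"
    using f by (auto simp: closed_proper_convex_def edom_def)
  have le: "f p + ereal (q p) \<le> f u + ereal (q u)" for u
    using min by (auto simp: is_arg_min_def not_less)
  show fin: "\<bar>f p\<bar> \<noteq> \<infinity>"
    using le[of u0] u0 proper[of p] by (cases "f p"; cases "f u0") auto
  then obtain a where a: "f p = ereal a" by auto
  have "f p + ereal (- d \<bullet> (u - p)) \<le> f u" for u
  proof (cases "f u")
    case (real b)
    have quotient: "a - b \<le> (q (p + t *\<^sub>R (u - p)) - q p) / t" if t: "0 < t" "t < 1" for t
    proof -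
      have "(1 - t) *\<^sub>R (p, a) + t *\<^sub>R (u, b) \<in> epi f"
        using conv t a real by (intro convexD_alt) (auto simp: epi_def)
      moreover have "(1 - t) *\<^sub>R p + t *\<^sub>R u = p + t *\<^sub>R (u - p)"
        by (simp add: algebra_simps)
      ultimately have "f (p + t *\<^sub>R (u - p)) \<le> ereal ((1 - t) * a + t * b)"
        by (simp add: epi_def)
      then have "ereal (a + q p) \<le> ereal ((1 - t) * a + t * b + q (p + t *\<^sub>R (u - p)))"
        using le[of "p + t *\<^sub>R (u - p)"] a
        by (cases "f (p + t *\<^sub>R (u - p))") auto
      then have "t * (a - b) \<le> q (p + t *\<^sub>R (u - p)) - q p"
        by (simp add: algebra_simps)
      then show ?thesis using t by (simp add: field_simps)
    qed
    have "((\<lambda>t. q (p + t *\<^sub>R (u - p))) has_derivative (\<lambda>s. d \<bullet> (s *\<^sub>R (u - p)))) (at 0)"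
    proof -
      have "(q has_derivative (\<lambda>h. d \<bullet> h)) (at (p + 0 *\<^sub>R (u - p)))"
        using deriv by simp
      then show ?thesis
        by (rule has_derivative_compose[rotated]) (auto intro!: derivative_eq_intros)
    qed
    then have "((\<lambda>t. q (p + t *\<^sub>R (u - p))) has_field_derivative d \<bullet> (u - p)) (at 0)"
      by (simp add: has_field_derivative_def mult_commute_abs)
    then have "((\<lambda>t. (q (p + t *\<^sub>R (u - p)) - q p) / t) \<longlongrightarrow> d \<bullet> (u - p)) (at 0)"
      by (simp add: DERIV_def)
    then have "((\<lambda>t. (q (p + t *\<^sub>R (u - p)) - q p) / t) \<longlongrightarrow> d \<bullet> (u - p)) (at_right 0)"
      by (rule tendsto_mono[OF at_le, rotated]) simp
    moreover have "eventually (\<lambda>t. a - b \<le> (q (p + t *\<^sub>R (u - p)) - q p) / t) (at_right 0)"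
      unfolding eventually_at_right_field using quotient by (intro exI[of _ 1]) auto
    ultimately have "a - b \<le> d \<bullet> (u - p)"
      by (intro tendsto_lowerbound) auto
    then show ?thesis using a real by simp
  qed (use proper a in auto)
  then show "- d \<in> subdifferential f p" by (simp add: subdifferential_def)
qed

lemma psd_linear: "psd S \<Longrightarrow> linear S"
  by (simp add: psd_def self_adjoint_def)

lemma psd_symmetric: "psd S \<Longrightarrow> u \<bullet> S v = S u \<bullet> v"
  by (metis psd_def self_adjoint_def adjoint_works)

lemma seminorm_power2: "psd S \<Longrightarrow> (seminorm S u)\<^sup>2 = u \<bullet> S u"
  by (simp add: psd_def seminorm_def)

lemma seminorm_nonneg: "psd S \<Longrightarrow> 0 \<le> seminorm S u"
  by (simp add: psd_def seminorm_def)

text \<open>Both subproblems of the method have this shape, with the other block absorbed in \<open>b\<close>.\<close>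

lemma proximal_subproblem_optimality:
  fixes f :: "'a::euclidean_space \<Rightarrow> ereal" and A :: "'a \<Rightarrow> 'b::euclidean_space"
  assumes f: "closed_proper_convex f" and A: "linear A" and S: "psd S"
    and min: "is_arg_min
      (\<lambda>u. f u + ereal (- ((A u + b) \<bullet> z) + \<mu> / 2 * (norm (A u + b))\<^sup>2
                        + 1/2 * (seminorm S (u - a))\<^sup>2)) (\<lambda>_. True) p"
  shows "adjoint A (z - \<mu> *\<^sub>R (A p + b)) - S (p - a) \<in> subdifferential f p"
    and "\<bar>f p\<bar> \<noteq> \<infinity>"
proof -
  let ?q = "\<lambda>u. - ((A u + b) \<bullet> z) + \<mu> / 2 * ((A u + b) \<bullet> (A u + b))
               + 1/2 * ((u - a) \<bullet> S (u - a))"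
  let ?d = "- (adjoint A (z - \<mu> *\<^sub>R (A p + b)) - S (p - a))"
  have dA: "(A has_derivative A) (at p)" and dS: "(S has_derivative S) (at w)" for w
    using A psd_linear[OF S] by (simp_all add: linear_imp_has_derivative)
  have dSa: "((\<lambda>u. S (u - a)) has_derivative (\<lambda>h. S h)) (at p)"
    by (rule has_derivative_compose[where g = S and f = "\<lambda>u. u - a", OF _ dS])
       (auto intro!: derivative_eq_intros)
  have "(?q has_derivative (\<lambda>h. ?d \<bullet> h)) (at p)"
  proof -
    have "(?q has_derivative
        (\<lambda>h. - (A h \<bullet> z) + \<mu> / 2 * ((A p + b) \<bullet> A h + A h \<bullet> (A p + b))
             + 1/2 * ((p - a) \<bullet> S h + h \<bullet> S (p - a)))) (at p)"
      by (auto intro!: derivative_eq_intros dA dSa)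
    moreover have "(\<lambda>h. - (A h \<bullet> z) + \<mu> / 2 * ((A p + b) \<bullet> A h + A h \<bullet> (A p + b))
             + 1/2 * ((p - a) \<bullet> S h + h \<bullet> S (p - a))) = (\<lambda>h. ?d \<bullet> h)"
      using psd_symmetric[OF S, of "p - a"]
      by (auto simp: fun_eq_iff adjoint_clauses[OF A] inner_simps inner_commute algebra_simps)
    ultimately show ?thesis by simp
  qed
  moreover have "is_arg_min (\<lambda>u. f u + ereal (?q u)) (\<lambda>_. True) p"
    using min by (simp add: seminorm_power2[OF S] power2_norm_eq_inner)
  ultimately have "- ?d \<in> subdifferential f p" and "\<bar>f p\<bar> \<noteq> \<infinity>"
    using arg_min_add_differentiable_imp_subgradient[OF f, of ?q p ?d] by simp_all
  then show "adjoint A (z - \<mu> *\<^sub>R (A p + b)) - S (p - a) \<in> subdifferential f p"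
    and "\<bar>f p\<bar> \<noteq> \<infinity>" by simp_all
qed

section \<open>One proximal step with a varying metric\<close>

text \<open>The subgradient inequality at \<open>p\<close> is used twice: towards \<open>s\<close>, sharpened by the modulus
  \<open>\<Sigma>\<close>, and with weight \<open>\<beta> - 1\<close> towards \<open>q\<close>. The polarization identity turns the
  proximal part of the subgradient into a difference of squared seminorms, and the modulus pays for
  replacing \<open>S\<close> by \<open>S'\<close>. For \<open>\<beta> = 1\<close> the weight of \<open>f q\<close> vanishes, so the first step of the
  method may start outside the domain.\<close>

lemma proximal_step_inequality:
  fixes f :: "'a::euclidean_space \<Rightarrow> ereal"
  assumes modulus: "convexity_modulus f \<Sigma>" and S: "psd S" and change: "\<Sigma> \<succeq> (\<lambda>u. S' u - S u)"
    and p: "a - S (p - q) \<in> subdifferential f p" "\<bar>f p\<bar> \<noteq> \<infinity>"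
    and s: "w \<in> subdifferential f s" "\<bar>f s\<bar> \<noteq> \<infinity>"
    and q: "\<beta> = 1 \<or> \<bar>f q\<bar> \<noteq> \<infinity>" and \<beta>: "1 \<le> \<beta>"
  shows "\<beta> * real_of_ereal (f p) - (\<beta> - 1) * real_of_ereal (f q) - real_of_ereal (f s)
           + 1/2 * ((p - s) \<bullet> S' (p - s))
         \<le> a \<bullet> (\<beta> *\<^sub>R p - (\<beta> - 1) *\<^sub>R q - s) + 1/2 * ((q - s) \<bullet> S (q - s))"
proof -
  have \<Sigma>: "psd \<Sigma>" using modulus by (simp add: convexity_modulus_def)
  define F where "F u = real_of_ereal (f u)" for u
  have "f p < \<infinity>" "f s < \<infinity>" using p(2) s(2) by (auto simp: less_top)
  then have "f p + ereal ((a - S (p - q)) \<bullet> (s - p) + 1/2 * (seminorm \<Sigma> (s - p))\<^sup>2) \<le> f s"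
    using modulus p(1) s(1) unfolding convexity_modulus_def edom_def by blast
  then have towards_s: "F p + (a - S (p - q)) \<bullet> (s - p) + 1/2 * ((s - p) \<bullet> \<Sigma> (s - p)) \<le> F s"
    using p(2) s(2) unfolding F_def
    by (cases "f p"; cases "f s") (auto simp: seminorm_power2[OF \<Sigma>])
  have "0 \<le> (\<beta> - 1) * (F q - F p - (a - S (p - q)) \<bullet> (q - p))"
    using q real_subgradient_inequality[OF p, of q] \<beta> unfolding F_def
    by (cases "\<beta> = 1") (auto intro!: mult_nonneg_nonneg)
  also have "\<dots> = (\<beta> - 1) * (F q - F p) - a \<bullet> ((\<beta> - 1) *\<^sub>R (q - p))
                  - (\<beta> - 1) * ((p - q) \<bullet> S (p - q))"
    by (simp add: inner_simps algebra_simps inner_commute)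
  also have "\<dots> \<le> (\<beta> - 1) * (F q - F p) - a \<bullet> ((\<beta> - 1) *\<^sub>R (q - p))"
    using S \<beta> by (simp add: psd_def)
  finally have towards_q: "0 \<le> (\<beta> - 1) * (F q - F p) - a \<bullet> ((\<beta> - 1) *\<^sub>R (q - p))" .
  have metric: "(p - s) \<bullet> S' (p - s) \<le> (p - s) \<bullet> S (p - s) + (s - p) \<bullet> \<Sigma> (s - p)"
  proof -
    have "0 \<le> (p - s) \<bullet> (\<Sigma> (p - s) - (S' (p - s) - S (p - s)))"
      using change by (simp add: loewner_ge_def psd_def)
    moreover have "\<Sigma> (s - p) = - \<Sigma> (p - s)"
      using linear_neg[OF psd_linear[OF \<Sigma>], of "p - s"] by simp
    ultimately show ?thesis by (simp add: inner_simps algebra_simps)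
  qed
  have polarization: "2 * (S (p - q) \<bullet> (s - p))
      = (q - s) \<bullet> S (q - s) - (p - s) \<bullet> S (p - s) - (p - q) \<bullet> S (p - q)"
  proof -
    have "q - s = (p - s) - (p - q)" by simp
    then have "S (q - s) = S (p - s) - S (p - q)"
      by (metis linear_diff[OF psd_linear[OF S]])
    then have "(q - s) \<bullet> S (q - s) = ((p - s) - (p - q)) \<bullet> (S (p - s) - S (p - q))"
      by simp
    also have "\<dots> = (p - s) \<bullet> S (p - s) + (p - q) \<bullet> S (p - q) - (p - s) \<bullet> S (p - q)
                    - (p - q) \<bullet> S (p - s)"
      by (simp add: inner_diff_left inner_diff_right)
    also have "(p - q) \<bullet> S (p - s) = S (p - q) \<bullet> (p - s)" by (rule psd_symmetric[OF S])
    finally show ?thesis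
      by (simp add: inner_commute[of _ "S (p - q)"] inner_diff_right)
  qed
  have "0 \<le> (p - q) \<bullet> S (p - q)" using S by (simp add: psd_def)
  moreover have "a \<bullet> (\<beta> *\<^sub>R p - (\<beta> - 1) *\<^sub>R q - s)
      = - (a \<bullet> (s - p)) - a \<bullet> ((\<beta> - 1) *\<^sub>R (q - p))"
    by (simp add: inner_simps algebra_simps)
  ultimately show ?thesis
    using towards_s towards_q metric polarization unfolding F_def[symmetric]
    by (simp add: inner_diff_left algebra_simps)
qed

text \<open>The primal block error \<open>b\<close> and the dual error \<open>e\<close> interact only through a cross term,
  which the two squares lost in the polarization identities absorb.\<close>

lemma primal_dual_coupling_inequality:
  fixes e e' b b' \<rho> :: "'a::real_inner"
  assumes lam: "0 < lam" and \<rho>: "lam *\<^sub>R \<rho> = e - e'"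
  shows "e' \<bullet> \<rho> + lam * ((b' - b) \<bullet> (\<rho> - b'))
         \<le> 1 / (2 * lam) * ((norm e)\<^sup>2 - (norm e')\<^sup>2) + lam / 2 * ((norm b)\<^sup>2 - (norm b')\<^sup>2)"
proof -
  have e: "e = e' + lam *\<^sub>R \<rho>" using \<rho> by simp
  have "1 / (2 * lam) * ((norm e)\<^sup>2 - (norm e')\<^sup>2) + lam / 2 * ((norm b)\<^sup>2 - (norm b')\<^sup>2)
        - (e' \<bullet> \<rho> + lam * ((b' - b) \<bullet> (\<rho> - b')))
        = lam / 2 * (norm (\<rho> - (b' - b)))\<^sup>2"
    using lam unfolding e
    by (simp add: power2_norm_eq_inner inner_simps inner_commute field_simps)
  moreover have "0 \<le> lam / 2 * (norm (\<rho> - (b' - b)))\<^sup>2" using lam by simp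
  ultimately show ?thesis by linarith
qed

section \<open>The Lyapunov function of the method\<close>

locale accelerated_sPADMM_run =
  fixes f :: "'x::euclidean_space \<Rightarrow> ereal" and g :: "'y::euclidean_space \<Rightarrow> ereal"
    and A :: "'x \<Rightarrow> 'z::euclidean_space" and B :: "'y \<Rightarrow> 'z" and c :: 'z
    and \<Sigma>f :: "'x \<Rightarrow> 'x" and \<Sigma>g :: "'y \<Rightarrow> 'y"
    and S :: "nat \<Rightarrow> 'x \<Rightarrow> 'x" and T :: "nat \<Rightarrow> 'y \<Rightarrow> 'y"
    and lam \<tau> :: real
    and \<theta> :: "nat \<Rightarrow> real" and v :: "nat \<Rightarrow> 'y"
    and x :: "nat \<Rightarrow> 'x" and y :: "nat \<Rightarrow> 'y" and z :: "nat \<Rightarrow> 'z"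
    and xs :: 'x and ys :: 'y and zs :: 'z
  assumes f: "closed_proper_convex f" and g: "closed_proper_convex g"
    and A: "linear A" and B: "linear B"
    and f_modulus: "convexity_modulus f \<Sigma>f" and g_modulus: "convexity_modulus g \<Sigma>g"
    and lam: "0 < lam" and \<tau>: "0 < \<tau>" "\<tau> < 1"
    and S: "\<And>k. psd (S k)" and T: "\<And>k. psd (T k)"
    and KKT: "KKT_solution f g A B c xs ys zs"
    and run: "accelerated_sPADMM f g A B c lam \<tau> S T \<theta> v x y z"
    and S_change: "\<And>k. \<Sigma>f \<succeq> (\<lambda>u. S (Suc k) u - S k u)"
    and T_change: "\<And>k. \<Sigma>g \<succeq> (\<lambda>u. T (Suc k) u - T k u)"
begin

definition \<beta> :: "nat \<Rightarrow> real" where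
  "\<beta> k = 1 + real k * (1 - \<tau>)"

definition residual :: "nat \<Rightarrow> 'z" where
  "residual k = A (x k) + B (y k) - c"

text \<open>This is the multiplier that occurs in the optimality condition of the \<open>y\<close>-subproblem; see
  \<open>dual_predictor_Suc\<close>.\<close>

definition dual_predictor :: "nat \<Rightarrow> 'z" where
  "dual_predictor k = z k - (lam * (\<beta> k - 1)) *\<^sub>R residual k"

text \<open>The point whose affine average with \<open>y j\<close> is \<open>y (Suc j)\<close>, as in Nesterov's method. The
  extrapolated points \<open>v\<close> are chosen to give \<open>momentum_point_increment\<close>.\<close>

definition momentum_point :: "nat \<Rightarrow> 'y" where
  "momentum_point k = (case k of 0 \<Rightarrow> y 0 | Suc j \<Rightarrow> \<beta> j *\<^sub>R y (Suc j) - (\<beta> j - 1) *\<^sub>R y j)"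

definition lagrangian_gap :: "nat \<Rightarrow> real" where
  "lagrangian_gap k = real_of_ereal (f (x k)) + real_of_ereal (g (y k))
     - real_of_ereal (f xs) - real_of_ereal (g ys) - zs \<bullet> residual k"

definition energy :: "nat \<Rightarrow> real" where
  "energy k = 1 / (2 * lam) * (norm (dual_predictor k - zs))\<^sup>2
     + lam / 2 * (norm (B (momentum_point k) - B ys))\<^sup>2
     + 1/2 * ((x k - xs) \<bullet> S k (x k - xs)) + 1/2 * ((y k - ys) \<bullet> T k (y k - ys))"

lemma \<beta>_ge_1: "1 \<le> \<beta> k"
  using \<tau> by (simp add: \<beta>_def)

lemma \<beta>_Suc: "\<beta> (Suc k) - 1 = \<beta> k - \<tau>"
  by (simp add: \<beta>_def algebra_simps)

lemma \<theta>_eq: "\<theta> k = 1 / \<beta> k"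
proof (induction k)
  case 0
  have "\<theta> 0 = 1 / (1 - \<tau> + 1 / prev (1 / \<tau>) \<theta> 0)"
    using run unfolding accelerated_sPADMM_def by blast
  then show ?case by (simp add: prev_def \<beta>_def)
next
  case (Suc k)
  have "\<theta> (Suc k) = 1 / (1 - \<tau> + 1 / prev (1 / \<tau>) \<theta> (Suc k))"
    using run unfolding accelerated_sPADMM_def by blast
  then show ?case using Suc \<beta>_Suc[of k] by (simp add: prev_def algebra_simps)
qed

lemma momentum_point_increment:
  "\<beta> k *\<^sub>R (y (Suc k) - v k) = momentum_point (Suc k) - momentum_point k"
proof -
  have v: "v k = y k + (\<theta> k * (1 - prev (1 / \<tau>) \<theta> k) / prev (1 / \<tau>) \<theta> k) *\<^sub>R
                 (y k - prev (y 0) y k)"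
    using run unfolding accelerated_sPADMM_def by blast
  show ?thesis
  proof (cases k)
    case 0
    then show ?thesis using v by (simp add: prev_def momentum_point_def \<beta>_def)
  next
    case (Suc j)
    have "\<beta> j \<noteq> 0" "\<beta> (Suc j) \<noteq> 0" using \<beta>_ge_1[of j] \<beta>_ge_1[of "Suc j"] by auto
    then have "\<theta> k * (1 - prev (1 / \<tau>) \<theta> k) / prev (1 / \<tau>) \<theta> k = (\<beta> j - 1) / \<beta> k"
      using Suc by (simp add: prev_def \<theta>_eq field_simps)
    then have "\<beta> k *\<^sub>R v k = \<beta> k *\<^sub>R y k + (\<beta> j - 1) *\<^sub>R (y k - y j)"
      using v Suc \<open>\<beta> (Suc j) \<noteq> 0\<close> by (simp add: prev_def scaleR_add_right)
    then show ?thesis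
      by (simp add: Suc momentum_point_def algebra_simps)
  qed
qed

lemma z_Suc: "z (Suc k) = z k - (\<tau> * lam) *\<^sub>R residual (Suc k)"
  using run unfolding accelerated_sPADMM_def residual_def by blast

lemma dual_predictor_Suc: "dual_predictor (Suc k) = z k - (lam * \<beta> k) *\<^sub>R residual (Suc k)"
  by (simp add: dual_predictor_def z_Suc \<beta>_Suc algebra_simps)

text \<open>The penalty parameters are tied to the multiplier step length by \<open>\<beta>_Suc\<close>, so the dual
  increment is exactly the residual of the averaged step.\<close>

lemma dual_predictor_increment:
  "lam *\<^sub>R (\<beta> k *\<^sub>R residual (Suc k) - (\<beta> k - 1) *\<^sub>R residual k)
     = dual_predictor k - dual_predictor (Suc k)"
  unfolding dual_predictor_Suc by (simp add: dual_predictor_def algebra_simps)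

lemma x_step:
  shows "adjoint A (dual_predictor (Suc k)
             + lam *\<^sub>R (B (momentum_point (Suc k)) - B (momentum_point k)))
           - S k (x (Suc k) - x k) \<in> subdifferential f (x (Suc k))" (is ?subgradient)
    and "\<bar>f (x (Suc k))\<bar> \<noteq> \<infinity>" (is ?finite)
proof -
  have "is_arg_min (\<lambda>u. aug_lagrangian f (\<lambda>_. 0) A B c (lam / \<theta> k) u (v k) (z k)
          + ereal (1/2 * (seminorm (S k) (u - x k))\<^sup>2)) (\<lambda>_. True) (x (Suc k))"
    using run unfolding accelerated_sPADMM_def by blast
  then have "is_arg_min (\<lambda>u. f u + ereal (- ((A u + (B (v k) - c)) \<bullet> z k)
          + (lam * \<beta> k) / 2 * (norm (A u + (B (v k) - c)))\<^sup>2
          + 1/2 * (seminorm (S k) (u - x k))\<^sup>2)) (\<lambda>_. True) (x (Suc k))"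
    by (simp add: aug_lagrangian_def \<theta>_eq add.assoc add_diff_eq)
  note optimal = proximal_subproblem_optimality[OF f A S this]
  have "(lam * \<beta> k) *\<^sub>R (A (x (Suc k)) + (B (v k) - c))
      = (lam * \<beta> k) *\<^sub>R residual (Suc k) - lam *\<^sub>R B (\<beta> k *\<^sub>R (y (Suc k) - v k))"
    by (simp add: residual_def linear_diff[OF B] linear_cmul[OF B] algebra_simps)
  then have "z k - (lam * \<beta> k) *\<^sub>R (A (x (Suc k)) + (B (v k) - c)) = dual_predictor (Suc k)
      + lam *\<^sub>R (B (momentum_point (Suc k)) - B (momentum_point k))"
    unfolding momentum_point_increment
    by (simp add: dual_predictor_Suc linear_diff[OF B] algebra_simps)
  then show ?subgradient ?finite using optimal by simp_all
qed

lemma y_step: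
  shows "adjoint B (dual_predictor (Suc k)) - T k (y (Suc k) - y k)
           \<in> subdifferential g (y (Suc k))" (is ?subgradient)
    and "\<bar>g (y (Suc k))\<bar> \<noteq> \<infinity>" (is ?finite)
proof -
  define a where "a = real_of_ereal (f (x (Suc k)))"
  have a: "f (x (Suc k)) = ereal a" using x_step(2)[of k] by (simp add: a_def ereal_real')
  have "is_arg_min (\<lambda>u. aug_lagrangian f g A B c (lam / \<theta> k) (x (Suc k)) u (z k)
          + ereal (1/2 * (seminorm (T k) (u - y k))\<^sup>2)) (\<lambda>_. True) (y (Suc k))"
    using run unfolding accelerated_sPADMM_def by blast
  moreover have "aug_lagrangian f g A B c (lam / \<theta> k) (x (Suc k)) u (z k)
          + ereal (1/2 * (seminorm (T k) (u - y k))\<^sup>2)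
      = ereal a + (g u + ereal (- ((B u + (A (x (Suc k)) - c)) \<bullet> z k)
          + (lam * \<beta> k) / 2 * (norm (B u + (A (x (Suc k)) - c)))\<^sup>2
          + 1/2 * (seminorm (T k) (u - y k))\<^sup>2))" for u
    by (cases "g u") (simp_all add: aug_lagrangian_def a \<theta>_eq algebra_simps)
  ultimately have "is_arg_min (\<lambda>u. g u + ereal (- ((B u + (A (x (Suc k)) - c)) \<bullet> z k)
          + (lam * \<beta> k) / 2 * (norm (B u + (A (x (Suc k)) - c)))\<^sup>2
          + 1/2 * (seminorm (T k) (u - y k))\<^sup>2)) (\<lambda>_. True) (y (Suc k))"
    unfolding is_arg_min_def not_less by (simp add: ereal_less_add not_less ereal_add_le_add_iff)
  note optimal = proximal_subproblem_optimality[OF g B T this]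
  have "z k - (lam * \<beta> k) *\<^sub>R (B (y (Suc k)) + (A (x (Suc k)) - c)) = dual_predictor (Suc k)"
    by (simp add: dual_predictor_Suc residual_def algebra_simps)
  then show ?subgradient ?finite using optimal by simp_all
qed

lemma solution:
  shows "A xs + B ys = c"
    and "adjoint A zs \<in> subdifferential f xs" and "\<bar>f xs\<bar> \<noteq> \<infinity>"
    and "adjoint B zs \<in> subdifferential g ys" and "\<bar>g ys\<bar> \<noteq> \<infinity>"
proof -
  show "A xs + B ys = c" using KKT by (simp add: KKT_solution_def)
  show xs: "adjoint A zs \<in> subdifferential f xs" and ys: "adjoint B zs \<in> subdifferential g ys"
    using KKT by (auto simp: KKT_solution_def)
  show "\<bar>f xs\<bar> \<noteq> \<infinity>" "\<bar>g ys\<bar> \<noteq> \<infinity>"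
    using proper_subdifferential_imp_finite[OF f xs]
      proper_subdifferential_imp_finite[OF g ys] by simp_all
qed

lemma residual_eq: "residual k = A (x k - xs) + B (y k - ys)"
  using solution(1) by (simp add: residual_def linear_diff[OF A] linear_diff[OF B] algebra_simps)

text \<open>A saddle point minimizes the Lagrangian with multiplier \<open>zs\<close>. Index \<open>0\<close> is excluded because
  \<open>f (x 0)\<close> or \<open>g (y 0)\<close> may be infinite, and \<open>lagrangian_gap 0\<close> meaningless.\<close>

lemma lagrangian_gap_nonneg: "0 \<le> lagrangian_gap (Suc k)"
proof -
  have "real_of_ereal (f xs) + zs \<bullet> A (x (Suc k) - xs) \<le> real_of_ereal (f (x (Suc k)))"
    using real_subgradient_inequality[OF solution(2,3) x_step(2)[of k]]
    by (simp add: adjoint_clauses[OF A])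
  moreover have "real_of_ereal (g ys) + zs \<bullet> B (y (Suc k) - ys) \<le> real_of_ereal (g (y (Suc k)))"
    using real_subgradient_inequality[OF solution(4,5) y_step(2)[of k]]
    by (simp add: adjoint_clauses[OF B])
  moreover have "zs \<bullet> residual (Suc k) = zs \<bullet> A (x (Suc k) - xs) + zs \<bullet> B (y (Suc k) - ys)"
    by (simp add: residual_eq inner_add_right)
  ultimately show ?thesis by (simp add: lagrangian_gap_def)
qed

text \<open>Adding the two proximal step inequalities, the multipliers pair with the averaged
  residual, which is the dual increment divided by \<open>lam\<close>. What is left over, because the
  \<open>x\<close>-subproblem used \<open>v k\<close> instead of \<open>y (Suc k)\<close>, is the cross term of
  \<open>primal_dual_coupling_inequality\<close>.\<close>

lemma energy_step:
  "\<beta> k * lagrangian_gap (Suc k) + energy (Suc k) \<le> (\<beta> k - 1) * lagrangian_gap k + energy k"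
proof -
  define b where "b j = B (momentum_point j) - B ys" for j
  define e where "e j = dual_predictor j - zs" for j
  define \<rho> where "\<rho> = \<beta> k *\<^sub>R residual (Suc k) - (\<beta> k - 1) *\<^sub>R residual k"
  define F where "F j = real_of_ereal (f (x j))" for j
  define G where "G j = real_of_ereal (g (y j))" for j
  define X where "X = \<beta> k *\<^sub>R x (Suc k) - (\<beta> k - 1) *\<^sub>R x k - xs"
  define Y where "Y = \<beta> k *\<^sub>R y (Suc k) - (\<beta> k - 1) *\<^sub>R y k - ys"
  define P where "P j = (x j - xs) \<bullet> S j (x j - xs)" for j
  define Q where "Q j = (y j - ys) \<bullet> T j (y j - ys)" for j
  \<comment> \<open>Only the starting point can lie outside the domains, and there \<open>\<beta> 0 = 1\<close>.\<close>
  have "\<beta> k = 1 \<or> \<bar>f (x k)\<bar> \<noteq> \<infinity>" and "\<beta> k = 1 \<or> \<bar>g (y k)\<bar> \<noteq> \<infinity>"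
    using x_step(2) y_step(2) by (cases k; simp add: \<beta>_def)+
  note start = this
  have BY: "B Y = b (Suc k)"
    by (simp add: Y_def b_def momentum_point_def linear_diff[OF B])
  have "A X + B Y = \<rho>"
    unfolding X_def Y_def \<rho>_def residual_eq
    by (simp add: linear_add[OF A] linear_add[OF B] linear_diff[OF A] linear_diff[OF B]
        linear_cmul[OF A] linear_cmul[OF B]
        algebra_simps)
  then have AX: "A X = \<rho> - b (Suc k)" using BY by (simp add: algebra_simps)
  have "\<beta> k * F (Suc k) - (\<beta> k - 1) * F k - real_of_ereal (f xs) + 1/2 * P (Suc k)
      \<le> adjoint A (dual_predictor (Suc k) + lam *\<^sub>R (b (Suc k) - b k)) \<bullet> X + 1/2 * P k"
    using proximal_step_inequality[OF f_modulus S S_change x_step solution(2,3) start(1) \<beta>_ge_1]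
    by (simp add: F_def P_def X_def b_def)
  also have "adjoint A (dual_predictor (Suc k) + lam *\<^sub>R (b (Suc k) - b k)) \<bullet> X
      = (dual_predictor (Suc k) + lam *\<^sub>R (b (Suc k) - b k)) \<bullet> (\<rho> - b (Suc k))"
    by (simp add: adjoint_clauses[OF A] AX)
  finally have x: "\<beta> k * F (Suc k) - (\<beta> k - 1) * F k - real_of_ereal (f xs) + 1/2 * P (Suc k)
      \<le> (dual_predictor (Suc k) + lam *\<^sub>R (b (Suc k) - b k)) \<bullet> (\<rho> - b (Suc k)) + 1/2 * P k" .
  have "\<beta> k * G (Suc k) - (\<beta> k - 1) * G k - real_of_ereal (g ys) + 1/2 * Q (Suc k)
      \<le> adjoint B (dual_predictor (Suc k)) \<bullet> Y + 1/2 * Q k"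
    using proximal_step_inequality[OF g_modulus T T_change y_step solution(4,5) start(2) \<beta>_ge_1]
    by (simp add: G_def Q_def Y_def)
  also have "adjoint B (dual_predictor (Suc k)) \<bullet> Y = dual_predictor (Suc k) \<bullet> b (Suc k)"
    by (simp add: adjoint_clauses[OF B] BY)
  finally have y: "\<beta> k * G (Suc k) - (\<beta> k - 1) * G k - real_of_ereal (g ys) + 1/2 * Q (Suc k)
      \<le> dual_predictor (Suc k) \<bullet> b (Suc k) + 1/2 * Q k" .
  have coupling: "e (Suc k) \<bullet> \<rho> + lam * ((b (Suc k) - b k) \<bullet> (\<rho> - b (Suc k)))
      \<le> 1 / (2 * lam) * ((norm (e k))\<^sup>2 - (norm (e (Suc k)))\<^sup>2)
        + lam / 2 * ((norm (b k))\<^sup>2 - (norm (b (Suc k)))\<^sup>2)"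
    using dual_predictor_increment[of k] lam
    by (intro primal_dual_coupling_inequality) (simp_all add: \<rho>_def e_def)
  have "\<beta> k * lagrangian_gap (Suc k) - (\<beta> k - 1) * lagrangian_gap k
      = (\<beta> k * F (Suc k) - (\<beta> k - 1) * F k - real_of_ereal (f xs))
        + (\<beta> k * G (Suc k) - (\<beta> k - 1) * G k - real_of_ereal (g ys)) - zs \<bullet> \<rho>"
    by (simp add: lagrangian_gap_def F_def G_def \<rho>_def inner_diff_right algebra_simps)
  also have "\<dots> \<le> (dual_predictor (Suc k) + lam *\<^sub>R (b (Suc k) - b k)) \<bullet> (\<rho> - b (Suc k))
        + dual_predictor (Suc k) \<bullet> b (Suc k) - zs \<bullet> \<rho>
        + 1/2 * (P k - P (Suc k)) + 1/2 * (Q k - Q (Suc k))"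
    using x y by (simp add: algebra_simps)
  \<comment> \<open>The terms \<open>dual_predictor (Suc k) \<bullet> b (Suc k)\<close> of the two blocks cancel.\<close>
  also have "\<dots> = e (Suc k) \<bullet> \<rho> + lam * ((b (Suc k) - b k) \<bullet> (\<rho> - b (Suc k)))
        + 1/2 * (P k - P (Suc k)) + 1/2 * (Q k - Q (Suc k))"
    by (simp add: e_def inner_add_left inner_diff_left inner_diff_right algebra_simps)
  also have "\<dots> \<le> energy k - energy (Suc k)"
    using coupling by (simp add: energy_def P_def Q_def b_def e_def algebra_simps)
  finally show ?thesis by simp
qed

text \<open>The steps telescope because \<open>\<beta> (Suc k) - 1 \<le> \<beta> k\<close>, and \<open>\<beta> 0 - 1 = 0\<close> removes the gap of
  the starting point.\<close>

lemma energy_bound: "\<beta> k * lagrangian_gap (Suc k) + energy (Suc k) \<le> energy 0"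
proof (induction k)
  case 0
  show ?case using energy_step[of 0] by (simp add: \<beta>_def)
next
  case (Suc k)
  have "(\<beta> (Suc k) - 1) * lagrangian_gap (Suc k) \<le> \<beta> k * lagrangian_gap (Suc k)"
    using \<tau> by (intro mult_right_mono lagrangian_gap_nonneg) (simp add: \<beta>_Suc)
  then show ?case using energy_step[of "Suc k"] Suc by linarith
qed

lemma energy_ge_dual_error: "(norm (dual_predictor k - zs))\<^sup>2 \<le> 2 * lam * energy k"
proof -
  have "0 \<le> (x k - xs) \<bullet> S k (x k - xs)" "0 \<le> (y k - ys) \<bullet> T k (y k - ys)"
    using S T by (simp_all add: psd_def)
  then have "1 / (2 * lam) * (norm (dual_predictor k - zs))\<^sup>2 \<le> energy k"
    using lam by (simp add: energy_def)
  then show ?thesis using lam by (simp add: field_simps)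
qed

lemma energy_nonneg: "0 \<le> energy k"
  using energy_ge_dual_error[of k] lam zero_le_power2[of "norm (dual_predictor k - zs)"]
  by (smt (verit) mult_pos_neg)

lemma dual_predictor_dist: "norm (dual_predictor k - zs) \<le> sqrt (2 * lam * energy 0)"
proof (rule real_le_rsqrt)
  have "energy k \<le> energy 0"
  proof (cases k)
    case (Suc j)
    have "0 \<le> \<beta> j * lagrangian_gap (Suc j)"
      using \<beta>_ge_1[of j] lagrangian_gap_nonneg[of j] by simp
    then show ?thesis using energy_bound[of j] unfolding Suc by linarith
  qed simp
  then show "(norm (dual_predictor k - zs))\<^sup>2 \<le> 2 * lam * energy 0"
    using energy_ge_dual_error[of k] lam by (smt (verit) mult_left_mono)
qed

text \<open>The damped multiplier update makes \<open>z (Suc k)\<close> a convex combination of \<open>z k\<close> and the predictor,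
  so the multipliers stay in any ball around \<open>zs\<close> that contains all predictors.\<close>

lemma multiplier_dist: "norm (z k - zs) \<le> sqrt (2 * lam * energy 0)"
proof (induction k)
  case 0
  show ?case using dual_predictor_dist[of 0] by (simp add: dual_predictor_def \<beta>_def)
next
  case (Suc k)
  let ?D = "cball zs (sqrt (2 * lam * energy 0))"
  have "z k \<in> ?D" "dual_predictor (Suc k) \<in> ?D"
    using Suc dual_predictor_dist[of "Suc k"] by (simp_all add: dist_norm norm_minus_commute)
  moreover have "\<tau> / \<beta> k \<le> 1" "0 \<le> \<tau> / \<beta> k" using \<tau> \<beta>_ge_1[of k] by simp_all
  ultimately have "(1 - \<tau> / \<beta> k) *\<^sub>R z k + (\<tau> / \<beta> k) *\<^sub>R dual_predictor (Suc k) \<in> ?D"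
    by (intro convexD_alt convex_cball)
  moreover have "z (Suc k) = (1 - \<tau> / \<beta> k) *\<^sub>R z k + (\<tau> / \<beta> k) *\<^sub>R dual_predictor (Suc k)"
    using \<beta>_ge_1[of k] by (simp add: z_Suc dual_predictor_Suc algebra_simps)
  ultimately show ?case by (simp add: dist_norm norm_minus_commute)
qed

lemma residual_bound: "lam * \<beta> k * norm (residual (Suc k)) \<le> 2 * sqrt (2 * lam * energy 0)"
proof -
  have "lam * \<beta> k * norm (residual (Suc k)) = norm ((lam * \<beta> k) *\<^sub>R residual (Suc k))"
    using lam \<beta>_ge_1[of k] by simp
  also have "(lam * \<beta> k) *\<^sub>R residual (Suc k) = (z k - zs) - (dual_predictor (Suc k) - zs)"
    by (simp add: dual_predictor_Suc)
  also have "norm \<dots> \<le> norm (z k - zs) + norm (dual_predictor (Suc k) - zs)"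
    by (rule norm_triangle_ineq4)
  finally show ?thesis using multiplier_dist[of k] dual_predictor_dist[of "Suc k"] by linarith
qed

lemma energy_0: "energy 0 = 1 / (2 * lam) * (norm (z 0 - zs))\<^sup>2
    + lam / 2 * (norm (B (y 0) - B ys))\<^sup>2
    + 1/2 * ((seminorm (S 0) (x 0 - xs))\<^sup>2 + (seminorm (T 0) (y 0 - ys))\<^sup>2)"
  by (simp add: energy_def dual_predictor_def momentum_point_def \<beta>_def seminorm_power2[OF S]
      seminorm_power2[OF T])

lemma sqrt_energy_0_le: "sqrt (2 * lam * energy 0)
    \<le> norm (z 0 - zs) + lam * norm (B (y 0) - B ys)
       + sqrt lam * (seminorm (S 0) (x 0 - xs) + seminorm (T 0) (y 0 - ys))"
proof -
  define n where "n = norm (z 0 - zs)"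
  define b where "b = lam * norm (B (y 0) - B ys)"
  define s where "s = sqrt lam * seminorm (S 0) (x 0 - xs)"
  define t where "t = sqrt lam * seminorm (T 0) (y 0 - ys)"
  have nonneg: "0 \<le> n" "0 \<le> b" "0 \<le> s" "0 \<le> t"
    using lam S T by (simp_all add: n_def b_def s_def t_def seminorm_nonneg)
  have "2 * lam * energy 0 = n\<^sup>2 + b\<^sup>2 + s\<^sup>2 + t\<^sup>2"
    using lam by (simp add: energy_0 n_def b_def s_def t_def power_mult_distrib field_simps
        power2_eq_square[of lam])
  also have "\<dots> \<le> (n + b + (s + t))\<^sup>2"
    using nonneg by (simp add: power2_eq_square algebra_simps add_nonneg_nonneg)
  finally have "sqrt (2 * lam * energy 0) \<le> n + b + (s + t)"
    using nonneg by (intro real_le_lsqrt) auto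
  then show ?thesis by (simp add: n_def b_def s_def t_def algebra_simps)
qed

end

section \<open>The convergence rate\<close>

theorem theorem2:
  fixes f :: "'x::euclidean_space \<Rightarrow> ereal"
    and g :: "'y::euclidean_space \<Rightarrow> ereal"
    and A :: "'x \<Rightarrow> 'z::euclidean_space"
    and B :: "'y \<Rightarrow> 'z"
    and c :: 'z
    and \<Sigma>f :: "'x \<Rightarrow> 'x" and \<Sigma>g :: "'y \<Rightarrow> 'y"
    and S :: "nat \<Rightarrow> 'x \<Rightarrow> 'x" and T :: "nat \<Rightarrow> 'y \<Rightarrow> 'y"
    and lam \<tau> C3 C4 :: real
    and \<theta> :: "nat \<Rightarrow> real" and v :: "nat \<Rightarrow> 'y"
    and x :: "nat \<Rightarrow> 'x" and y :: "nat \<Rightarrow> 'y" and z :: "nat \<Rightarrow> 'z"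
    and xs :: 'x and ys :: 'y and zs :: 'z
    and K :: nat
  assumes "closed_proper_convex f" and "closed_proper_convex g"
    and "linear A" and "linear B"
    and "convexity_modulus f \<Sigma>f" and "convexity_modulus g \<Sigma>g"
    and "lam > 0" and "0 < \<tau>" and "\<tau> < 1"
    and "\<And>k. psd (S k)" and "\<And>k. psd (T k)"
    and "KKT_solution f g A B c xs ys zs"
    and "accelerated_sPADMM f g A B c lam \<tau> S T \<theta> v x y z"
    and "\<And>k. pos_def (\<lambda>u. \<Sigma>f u + adjoint A (A u) + S k u)"
    and "\<And>k. pos_def (\<lambda>u. \<Sigma>g u + adjoint B (B u) + T k u)"
    and "\<And>k. \<Sigma>f \<succeq> (\<lambda>u. S (Suc k) u - S k u)"
    and "\<And>k. \<Sigma>g \<succeq> (\<lambda>u. T (Suc k) u - T k u)"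
    and "C3 = 2 / lam * norm (z 0 - zs) + norm (B (y 0) - B ys)
              + 1 / sqrt lam * (seminorm (S 0) (x 0 - xs) + seminorm (T 0) (y 0 - ys))"
    and "C4 = 1 / (2 * lam) * (norm (z 0 - zs))\<^sup>2 + lam / 2 * (norm (B (y 0) - B ys))\<^sup>2
              + 1/2 * ((seminorm (S 0) (x 0 - xs))\<^sup>2 + (seminorm (T 0) (y 0 - ys))\<^sup>2)"
  shows "ereal (- (2 * C3 * norm zs / (1 + real K * (1 - \<tau>))))
           \<le> f (x (Suc K)) + g (y (Suc K)) - f xs - g ys
       \<and> f (x (Suc K)) + g (y (Suc K)) - f xs - g ys
           \<le> ereal ((2 * C3 * norm zs + C4) / (1 + real K * (1 - \<tau>)))
       \<and> 0 \<le> norm (c - A (x (Suc K)) - B (y (Suc K)))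
       \<and> norm (c - A (x (Suc K)) - B (y (Suc K))) \<le> 2 * C3 / (1 + real K * (1 - \<tau>))"
proof -
  interpret accelerated_sPADMM_run f g A B c \<Sigma>f \<Sigma>g S T lam \<tau> \<theta> v x y z xs ys zs
    by (intro accelerated_sPADMM_run.intro assms)
  note C3 = assms(18) and C4 = assms(19)
  have \<beta>: "1 + real K * (1 - \<tau>) = \<beta> K" "0 < \<beta> K" using \<beta>_ge_1[of K] by (simp_all add: \<beta>_def)
  have "energy 0 = C4" by (simp add: energy_0 C4)
  have "sqrt (2 * lam * energy 0) \<le> lam * C3"
  proof -
    have "lam * C3 = 2 * norm (z 0 - zs) + lam * norm (B (y 0) - B ys)
        + sqrt lam * (seminorm (S 0) (x 0 - xs) + seminorm (T 0) (y 0 - ys))"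
      using lam unfolding C3 distrib_left mult.assoc[symmetric]
      by (simp add: real_div_sqrt)
    then show ?thesis using sqrt_energy_0_le norm_ge_zero[of "z 0 - zs"] by linarith
  qed
  then have "lam * (\<beta> K * norm (residual (Suc K))) \<le> lam * (2 * C3)"
    using residual_bound[of K] by (simp add: algebra_simps)
  then have "\<beta> K * norm (residual (Suc K)) \<le> 2 * C3" using lam by simp
  then have res: "norm (residual (Suc K)) \<le> 2 * C3 / \<beta> K"
    using \<beta> by (simp add: field_simps)
  have "\<bar>zs \<bullet> residual (Suc K)\<bar> \<le> norm zs * norm (residual (Suc K))"
    by (rule Cauchy_Schwarz_ineq2)
  also have "\<dots> \<le> norm zs * (2 * C3 / \<beta> K)" by (intro mult_left_mono res) simp
  finally have pairing: "\<bar>zs \<bullet> residual (Suc K)\<bar> \<le> 2 * C3 * norm zs / \<beta> K"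
    by (simp add: algebra_simps)
  have "0 \<le> energy (Suc K)"
    using energy_nonneg .
  then have "\<beta> K * lagrangian_gap (Suc K) \<le> C4" using energy_bound[of K] \<open>energy 0 = C4\<close> by linarith
  then have gap: "lagrangian_gap (Suc K) \<le> C4 / \<beta> K" using \<beta> by (simp add: field_simps)
  define d where "d = real_of_ereal (f (x (Suc K))) + real_of_ereal (g (y (Suc K)))
      - real_of_ereal (f xs) - real_of_ereal (g ys)"
  have d: "f (x (Suc K)) + g (y (Suc K)) - f xs - g ys = ereal d"
    using x_step(2)[of K] y_step(2)[of K] solution(3,5) unfolding d_def
    by (cases "f (x (Suc K))"; cases "g (y (Suc K))"; cases "f xs"; cases "g ys") auto
  have "d = lagrangian_gap (Suc K) + zs \<bullet> residual (Suc K)"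
    by (simp add: d_def lagrangian_gap_def)
  then have "- (2 * C3 * norm zs / \<beta> K) \<le> d" "d \<le> (2 * C3 * norm zs + C4) / \<beta> K"
    using pairing gap lagrangian_gap_nonneg[of K] by (auto simp: add_divide_distrib)
  moreover have "c - A (x (Suc K)) - B (y (Suc K)) = - residual (Suc K)"
    by (simp add: residual_def)
  ultimately show ?thesis using res unfolding d \<beta>(1) by simp
qed

end
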